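(* Let $(S,\mu,x_0)$ be a biunital Lie semiheap. Then non-zero left-invariant vector fields on $S$ exist.
   Context: All manifolds are real, finite dimensional, Hausdorff, second countable smooth manifolds. A Lie semiheap is a smooth manifold $S$ with a smooth map $\mu:S^3\to S$, $\mu(x,y,z)=[x,y,z]$, satisfying the para-associative law $[[x_1,x_2,x_3],x_4,x_5]=[x_1,[x_4,x_3,x_2],x_5]=[x_1,x_2,[x_3,x_4,x_5]]$ for all $x_i\in S$. A biunital Lie semiheap $(S,\mu,x_0)$ is a Lie semiheap with a distinguished point $x_0\in S$ such that $[x,x_0,x_0]=x=[x_0,x_0,x]$ for all $x\in S$. For $x,y\in S$ the left translation $L_{xy}:S\to S$ is $L_{xy}(z)=[x,y,z]$; $L(S)$ denotes the set of all left translations. A (smooth) vector field $X$ on $S$ is left-invariant if $l^*\circ X=X\circ l^*$ as operators on $C^\infty(S)$ for all $l\in L(S)$; equivalently $(\mathrm{d}L_{xy})_zX_z=X_{[x,y,z]}$ for all $x,y,z\in S$.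
   Formalization: The manifold S is assumed to have positive dimension; for a zero-dimensional S (for example a single point with [x,y,z]=x) the claim fails, since the only vector field is zero. *)

theory Defs
  imports "HOL-Analysis.Analysis"
begin

section \<open>Smooth functions on open subsets of Euclidean spaces\<close>

text \<open>
  The two notions below are meant for open sets \<open>U\<close> only, because
  the derivative is taken in the full space.  \<open>Ck_on k f U\<close> says that \<open>f\<close>
  has continuous iterated (directional) derivatives up to order \<open>k\<close>.
\<close>

primrec Ck_on ::
  "nat \<Rightarrow> ('a::real_normed_vector \<Rightarrow> 'b::real_normed_vector) \<Rightarrow> 'a set \<Rightarrow> bool"
where
  "Ck_on 0 f U \<longleftrightarrow> continuous_on U f"
| "Ck_on (Suc k) f U \<longleftrightarrow>
     (\<forall>x\<in>U. f differentiable (at x)) \<and>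
     (\<forall>v. Ck_on k (\<lambda>x. frechet_derivative f (at x) v) U)"

definition smooth_on ::
  "('a::real_normed_vector \<Rightarrow> 'b::real_normed_vector) \<Rightarrow> 'a set \<Rightarrow> bool"
where
  "smooth_on f U \<longleftrightarrow> (\<forall>k. Ck_on k f U)"


section \<open>Smooth manifolds\<close>

text \<open>
  The underlying topological space of a manifold is a type \<open>'s\<close> of class \<open>t2_space\<close>
  (Hausdorff) and \<open>second_countable_topology\<close>; the model space is a Euclidean space
  \<open>'e\<close>, so that the manifold has dimension \<open>DIM('e)\<close>.  Every type of class
  \<open>euclidean_space\<close> has positive dimension, hence zero-dimensional manifolds,
  all of whose vector fields vanish, do not occur here.

  A chart is a pair of a domain and a coordinate map; only the values of the
  coordinate map on the domain matter.
\<close>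

type_synonym ('s, 'e) chart = "'s set \<times> ('s \<Rightarrow> 'e)"

definition is_chart ::
  "('s::topological_space, 'e::euclidean_space) chart \<Rightarrow> bool"
where
  "is_chart = (\<lambda>(U, \<phi>). open U \<and> open (\<phi> ` U) \<and> homeomorphism U (\<phi> ` U) \<phi> (inv_into U \<phi>))"

text \<open>
  An atlas represents the smooth structure it generates.  It is not required to be
  maximal: all notions below depend only on the generated structure.
\<close>

definition smooth_atlas ::
  "('s::topological_space, 'e::euclidean_space) chart set \<Rightarrow> bool"
where
  "smooth_atlas A \<longleftrightarrow>
     (\<forall>c\<in>A. is_chart c) \<and>
     (\<Union>c\<in>A. fst c) = UNIV \<and>
     (\<forall>(U, \<phi>)\<in>A. \<forall>(V, \<psi>)\<in>A. smooth_on (\<psi> \<circ> inv_into U \<phi>) (\<phi> ` (U \<inter> V)))"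

definition prod_atlas ::
  "('s, 'e) chart set \<Rightarrow> ('t, 'f) chart set \<Rightarrow> ('s \<times> 't, 'e \<times> 'f) chart set"
where
  "prod_atlas A B = {(U \<times> V, map_prod \<phi> \<psi>) | U \<phi> V \<psi>. (U, \<phi>) \<in> A \<and> (V, \<psi>) \<in> B}"

definition smooth_map ::
  "('s::topological_space, 'e::euclidean_space) chart set \<Rightarrow>
   ('t::topological_space, 'f::euclidean_space) chart set \<Rightarrow> ('s \<Rightarrow> 't) \<Rightarrow> bool"
where
  "smooth_map A B F \<longleftrightarrow>
     continuous_on UNIV F \<and>
     (\<forall>(U, \<phi>)\<in>A. \<forall>(V, \<psi>)\<in>B. smooth_on (\<psi> \<circ> F \<circ> inv_into U \<phi>) (\<phi> ` (U \<inter> F -` V)))"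

definition smooth_functions ::
  "('s::topological_space, 'e::euclidean_space) chart set \<Rightarrow> ('s \<Rightarrow> real) set"
where
  "smooth_functions A = {f. smooth_map A {(UNIV :: real set, id)} f}"


section \<open>Tangent vectors and vector fields\<close>

text \<open>
  Tangent vectors at \<open>p\<close> are the derivations at \<open>p\<close> of the algebra of smooth functions.
  A derivation is only meaningful on smooth functions; it is made to vanish on all other
  functions so that equality of tangent vectors is equality of HOL functions, and the
  zero tangent vector is \<open>\<lambda>f. 0\<close>.
\<close>

definition tangent_space ::
  "('s::topological_space, 'e::euclidean_space) chart set \<Rightarrow> 's \<Rightarrow> (('s \<Rightarrow> real) \<Rightarrow> real) set"
where
  "tangent_space A p = {v.
     (\<forall>f\<in>smooth_functions A. \<forall>g\<in>smooth_functions A. \<forall>a b.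
        v (\<lambda>x. a * f x + b * g x) = a * v f + b * v g) \<and>
     (\<forall>f\<in>smooth_functions A. \<forall>g\<in>smooth_functions A.
        v (\<lambda>x. f x * g x) = f p * v g + g p * v f) \<and>
     (\<forall>f. f \<notin> smooth_functions A \<longrightarrow> v f = 0)}"

type_synonym 's vfield = "'s \<Rightarrow> ('s \<Rightarrow> real) \<Rightarrow> real"

definition vf_apply :: "'s vfield \<Rightarrow> ('s \<Rightarrow> real) \<Rightarrow> 's \<Rightarrow> real"
where
  "vf_apply X f = (\<lambda>p. X p f)"

definition smooth_vector_field ::
  "('s::topological_space, 'e::euclidean_space) chart set \<Rightarrow> 's vfield \<Rightarrow> bool"
where
  "smooth_vector_field A X \<longleftrightarrow>
     (\<forall>p. X p \<in> tangent_space A p) \<and>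
     (\<forall>f\<in>smooth_functions A. vf_apply X f \<in> smooth_functions A)"

definition zero_vector_field :: "'s vfield"
where
  "zero_vector_field = (\<lambda>p f. 0)"


section \<open>Lie semiheaps\<close>

locale lie_semiheap =
  fixes A :: "('s::{t2_space, second_countable_topology}, 'e::euclidean_space) chart set"
    and \<mu> :: "'s \<Rightarrow> 's \<Rightarrow> 's \<Rightarrow> 's"
  assumes atlas: "smooth_atlas A"
    and smooth_mu: "smooth_map (prod_atlas A (prod_atlas A A)) A (\<lambda>(x, y, z). \<mu> x y z)"
    and para_assoc_left: "\<mu> (\<mu> x1 x2 x3) x4 x5 = \<mu> x1 (\<mu> x4 x3 x2) x5"
    and para_assoc_right: "\<mu> x1 (\<mu> x4 x3 x2) x5 = \<mu> x1 x2 (\<mu> x3 x4 x5)"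

locale biunital_lie_semiheap = lie_semiheap A \<mu>
  for A :: "('s::{t2_space, second_countable_topology}, 'e::euclidean_space) chart set"
    and \<mu> :: "'s \<Rightarrow> 's \<Rightarrow> 's \<Rightarrow> 's" +
  fixes x0 :: 's
  assumes right_unit: "\<mu> x x0 x0 = x"
    and left_unit: "\<mu> x0 x0 x = x"

definition left_translations :: "('s \<Rightarrow> 's \<Rightarrow> 's \<Rightarrow> 's) \<Rightarrow> ('s \<Rightarrow> 's) set"
where
  "left_translations \<mu> = {\<lambda>z. \<mu> x y z | x y. True}"

definition pullback :: "('s \<Rightarrow> 't) \<Rightarrow> ('t \<Rightarrow> real) \<Rightarrow> 's \<Rightarrow> real"
where
  "pullback l f = f \<circ> l"

definition left_invariant ::
  "('s::topological_space, 'e::euclidean_space) chart set \<Rightarrow> ('s \<Rightarrow> 's \<Rightarrow> 's \<Rightarrow> 's) \<Rightarrow>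
   's vfield \<Rightarrow> bool"
where
  "left_invariant A \<mu> X \<longleftrightarrow>
     (\<forall>l\<in>left_translations \<mu>. \<forall>f\<in>smooth_functions A.
        pullback l (vf_apply X f) = vf_apply X (pullback l f))"

end

(*
  Writing l_p(q) = [p, x0, q], biunitality gives l_p(x0) = p, so a tangent vector v at x0 can be
  transported to X_p = d(l_p)(v).  Para-associativity gives [[x, y, p], x0, q] = [x, y, [p, x0, q]],
  that is, L_xy o l_p = l_[x,y,p], whence X is left-invariant.  In coordinates X f is a partial
  derivative of the smooth function (p, q) |-> f [p, x0, q] restricted to q = x0, so X is smooth.
  Since X_x0 = v, a bump function at x0 shows that X does not vanish if v is nonzero.
*)

theory Submission
  imports Defs
begin

section \<open>Calculus of smooth functions\<close>

text \<open>The maps l_p need not be invertible, so X may vanish at some points: for square matrices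
  with [x, y, z] = x y^T z and x0 the identity, X_p is the product p v, which is zero at p = 0.
  Being non-zero therefore means not identically zero, and x0 is the point at which to test it.
  Tangent vectors are derivations of the algebra of globally defined smooth functions.
  Differentiating in a chart turns a coordinate vector v into such a derivation, but seeing that it
  is non-zero takes a global smooth function with non-zero slope along v; this is why bump functions
  are built. Smoothness of X in p is the other obstacle: it needs joint smoothness in (p, q), hence
  product atlases and a chain rule for iterated directional derivatives.\<close>

lemma Ck_on_cong:
  assumes "open U" "\<And>x. x \<in> U \<Longrightarrow> f x = g x" "Ck_on k f U"
  shows "Ck_on k g U"
  using assms(2,3)
proof (induction k arbitrary: f g)
  case 0
  then show ?case by (simp cong: continuous_on_cong)
next
  case (Suc k)
  have d: "f differentiable (at x)" if "x \<in> U" for x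
    using Suc.prems that by simp
  have eq: "frechet_derivative f (at x) = frechet_derivative g (at x)" if "x \<in> U" for x
    using frechet_derivative_transform_within_open[OF d[OF that] \<open>open U\<close> that Suc.prems(1)]
    by simp
  have "g differentiable (at x)" if "x \<in> U" for x
    using d[OF that] Suc.prems(1) that \<open>open U\<close>
    by (meson differentiable_def has_derivative_transform_within_open)
  moreover have "Ck_on k (\<lambda>x. frechet_derivative g (at x) v) U" for v
    by (rule Suc.IH[of "\<lambda>x. frechet_derivative f (at x) v"]) (use eq Suc.prems in auto)
  ultimately show ?case by simp
qed

lemma Ck_on_subset: "Ck_on k f U \<Longrightarrow> V \<subseteq> U \<Longrightarrow> Ck_on k f V"
  by (induction k arbitrary: f) (auto intro: continuous_on_subset)

text \<open>Derivatives at a point are taken in the full space, so only some neighbourhood of the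
  point matters, even where it sticks out of \<open>U\<close>. This glues computations made in
  different charts.\<close>

lemma Ck_on_local:
  assumes "\<And>x. x \<in> U \<Longrightarrow> \<exists>W. open W \<and> x \<in> W \<and> Ck_on k f W"
  shows "Ck_on k f U"
  using assms
proof (induction k arbitrary: f)
  case 0
  have "isCont f x" if "x \<in> U" for x
    using 0[OF that] continuous_on_eq_continuous_at by auto
  then show ?case by (simp add: continuous_at_imp_continuous_on)
next
  case (Suc k)
  have "f differentiable (at x)" if "x \<in> U" for x
    using Suc.prems[OF that] by auto
  moreover have "Ck_on k (\<lambda>x. frechet_derivative f (at x) v) U" for v
  proof (rule Suc.IH)
    fix x assume "x \<in> U"
    then obtain W where "open W" "x \<in> W" "Ck_on (Suc k) f W"
      using Suc.prems by blast
    then show "\<exists>W. open W \<and> x \<in> W \<and> Ck_on k (\<lambda>x. frechet_derivative f (at x) v) W"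
      by auto
  qed
  ultimately show ?case by simp
qed

lemma Ck_on_continuous: "Ck_on k f U \<Longrightarrow> continuous_on U f"
  by (cases k) (auto intro!: differentiable_imp_continuous_on
      simp: differentiable_on_def differentiable_at_withinI)

text \<open>The recursion asks only differentiability of the function itself, so lowering the order
  takes an induction, whose base case is that differentiable functions are continuous.\<close>

lemma Ck_on_Suc_D: "Ck_on (Suc k) f U \<Longrightarrow> Ck_on k f U"
proof (induction k arbitrary: f)
  case 0
  show ?case using Ck_on_continuous[OF 0] by simp
next
  case (Suc k)
  show ?case
    \<comment> \<open>Premise and goal are unfolded by one level each, so that the directional
      derivatives appear with the orders of the induction hypothesis.\<close>
    unfolding Ck_on.simps(2)[of k] using Suc.prems Suc.IH by (simp del: Ck_on.simps(2) add: Ck_on.simps(2)[of "Suc k"])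
qed

lemma Ck_on_Suc_has_derivative:
  assumes "Ck_on (Suc k) f U" "x \<in> U"
  shows "(f has_derivative frechet_derivative f (at x)) (at x)"
  using assms frechet_derivative_works by auto

text \<open>Uniqueness of derivatives lets an explicit formula \<open>f'\<close> stand in for
  \<open>frechet_derivative\<close>. The two agree on \<open>U\<close> only, whence the detour
  through \<open>Ck_on_cong\<close>.\<close>

lemma Ck_on_SucI:
  assumes "open U"
    and der: "\<And>x. x \<in> U \<Longrightarrow> (f has_derivative f' x) (at x)"
    and Ck: "\<And>v. Ck_on k (\<lambda>x. f' x v) U"
  shows "Ck_on (Suc k) f U"
proof -
  have "f' x = frechet_derivative f (at x)" if "x \<in> U" for x
    using der[OF that] by (rule frechet_derivative_at)
  then have "Ck_on k (\<lambda>x. frechet_derivative f (at x) v) U" for v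
    using Ck_on_cong[OF \<open>open U\<close> _ Ck[of v]] by simp
  then show ?thesis
    using der by (auto simp: differentiable_def)
qed

lemma Ck_on_const: "Ck_on k (\<lambda>x. c) U"
  by (induction k arbitrary: c) auto

lemma Ck_on_bounded_linear:
  assumes "bounded_linear T" "open U"
  shows "Ck_on k T U"
proof (cases k)
  case 0
  then show ?thesis using assms by (simp add: linear_continuous_on)
next
  case (Suc j)
  show ?thesis
    unfolding Suc
    by (rule Ck_on_SucI[where f' = "\<lambda>x. T"])
      (use assms in \<open>auto intro: bounded_linear_imp_has_derivative Ck_on_const\<close>)
qed

lemma Ck_on_add:
  assumes "open U" "Ck_on k f U" "Ck_on k g U"
  shows "Ck_on k (\<lambda>x. f x + g x) U"
  using assms(2,3)
proof (induction k arbitrary: f g)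
  case 0
  then show ?case by (auto intro: continuous_on_add)
next
  case (Suc k)
  show ?case
    by (rule Ck_on_SucI[OF \<open>open U\<close> has_derivative_add])
      (use Suc in \<open>auto intro: Ck_on_Suc_has_derivative\<close>)
qed

lemma Ck_on_sum:
  assumes "open U" "\<And>i. i \<in> I \<Longrightarrow> Ck_on k (f i) U"
  shows "Ck_on k (\<lambda>x. \<Sum>i\<in>I. f i x) U"
  using assms(2)
  by (induction I rule: infinite_finite_induct) (auto intro: Ck_on_add[OF \<open>open U\<close>] Ck_on_const)

text \<open>By the product rule the derivative is again a sum of bilinear terms, one factor of each
  being undifferentiated; that factor is handled by \<open>Ck_on_Suc_D\<close>. Products, scalar
  multiples and inner products are all instances.\<close>

lemma Ck_on_bounded_bilinear:
  assumes "bounded_bilinear B" "open U" "Ck_on k f U" "Ck_on k g U"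
  shows "Ck_on k (\<lambda>x. B (f x) (g x)) U"
  using assms(3,4)
proof (induction k arbitrary: f g)
  case 0
  then show ?case by (simp add: bounded_bilinear.continuous_on[OF assms(1)])
next
  case (Suc k)
  have "Ck_on k f U" "Ck_on k g U"
    using Suc.prems Ck_on_Suc_D by blast+
  moreover have "Ck_on k (\<lambda>x. frechet_derivative f (at x) v) U"
    "Ck_on k (\<lambda>x. frechet_derivative g (at x) v) U" for v
    using Suc.prems by auto
  ultimately show ?case
    by (intro Ck_on_SucI[OF \<open>open U\<close> bounded_bilinear.FDERIV[OF assms(1)]])
      (auto intro!: Ck_on_Suc_has_derivative[OF Suc.prems(1)] Ck_on_Suc_has_derivative[OF Suc.prems(2)]
        Ck_on_add[OF \<open>open U\<close>] Suc.IH)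
qed

text \<open>In the chain rule \<open>g' (f x) (f' x v)\<close> the direction fed to
  \<open>g'\<close> varies with x, whereas \<open>Ck_on\<close> controls fixed directions only.
  Expanding \<open>f' x v\<close> in the finite basis of the middle space leaves the fixed
  directions b, to which the induction hypothesis for \<open>g\<close> applies.\<close>

lemma Ck_on_compose:
  fixes f :: "'a::real_normed_vector \<Rightarrow> 'b::euclidean_space"
    and g :: "'b \<Rightarrow> 'c::real_normed_vector"
  assumes "open U" "f ` U \<subseteq> V" "Ck_on k f U" "Ck_on k g V"
  shows "Ck_on k (\<lambda>x. g (f x)) U"
  using assms(3,4)
proof (induction k arbitrary: g)
  case 0
  then show ?case using assms(2) by (auto intro: continuous_on_compose2)
next
  case (Suc k)
  define f' where "f' = (\<lambda>x. frechet_derivative f (at x))"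
  define g' where "g' = (\<lambda>y. frechet_derivative g (at y))"
  have f': "(f has_derivative f' x) (at x)" if "x \<in> U" for x
    unfolding f'_def using Suc.prems(1) that by (rule Ck_on_Suc_has_derivative)
  have g': "(g has_derivative g' (f x)) (at (f x))" if "x \<in> U" for x
    unfolding g'_def using Suc.prems(2) by (rule Ck_on_Suc_has_derivative) (use assms(2) that in auto)
  have "Ck_on k f U"
    using Suc.prems(1) by (rule Ck_on_Suc_D)
  then have comp: "Ck_on k (\<lambda>x. g' (f x) b) U" for b
    using Suc.IH[of "\<lambda>y. g' y b"] Suc.prems(2) by (simp add: g'_def)
  show ?case
  proof (rule Ck_on_SucI[OF \<open>open U\<close>])
    show "((\<lambda>x. g (f x)) has_derivative (\<lambda>v. g' (f x) (f' x v))) (at x)" if "x \<in> U" for x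
      using f'[OF that] g'[OF that] by (rule has_derivative_compose)
    fix v
    have "Ck_on k (\<lambda>x. f' x v) U"
      using Suc.prems(1) by (simp add: f'_def)
    then have "Ck_on k (\<lambda>x. f' x v \<bullet> b) U" for b
      by (intro Ck_on_bounded_bilinear[OF bounded_bilinear_inner \<open>open U\<close>] Ck_on_const)
    then have "Ck_on k (\<lambda>x. \<Sum>b\<in>Basis. (f' x v \<bullet> b) *\<^sub>R g' (f x) b) U"
      by (intro Ck_on_sum[OF \<open>open U\<close>] Ck_on_bounded_bilinear[OF bounded_bilinear_scaleR \<open>open U\<close>] comp)
    moreover have "(\<Sum>b\<in>Basis. (f' x v \<bullet> b) *\<^sub>R g' (f x) b) = g' (f x) (f' x v)" if "x \<in> U" for x
    proof -
      interpret linear "g' (f x)"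
        using g'[OF that] by (rule has_derivative_linear)
      have "g' (f x) (f' x v) = g' (f x) (\<Sum>b\<in>Basis. (f' x v \<bullet> b) *\<^sub>R b)"
        by (simp add: euclidean_representation)
      then show ?thesis by (simp add: sum scaleR)
    qed
    ultimately show "Ck_on k (\<lambda>x. g' (f x) (f' x v)) U"
      using Ck_on_cong[OF \<open>open U\<close>] by (metis (no_types, lifting))
  qed
qed

section \<open>Closure properties of infinitely differentiable functions\<close>

lemma smooth_on_cong:
  assumes "smooth_on f U" "open U" "\<And>x. x \<in> U \<Longrightarrow> f x = g x"
  shows "smooth_on g U"
  using assms Ck_on_cong unfolding smooth_on_def by blast

lemma smooth_on_subset: "smooth_on f U \<Longrightarrow> V \<subseteq> U \<Longrightarrow> smooth_on f V"
  unfolding smooth_on_def using Ck_on_subset by blast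

lemma smooth_on_local:
  assumes "\<And>x. x \<in> U \<Longrightarrow> \<exists>W. open W \<and> x \<in> W \<and> smooth_on f W"
  shows "smooth_on f U"
  using assms unfolding smooth_on_def by (meson Ck_on_local)

lemma smooth_on_continuous: "smooth_on f U \<Longrightarrow> continuous_on U f"
  unfolding smooth_on_def using Ck_on_continuous by blast

lemma smooth_on_has_derivative:
  assumes "smooth_on f U" "x \<in> U"
  shows "(f has_derivative frechet_derivative f (at x)) (at x)"
  using assms Ck_on_Suc_has_derivative unfolding smooth_on_def by blast

lemma smooth_on_derivative: "smooth_on f U \<Longrightarrow> smooth_on (\<lambda>x. frechet_derivative f (at x) v) U"
  unfolding smooth_on_def using Ck_on.simps(2) by blast

lemma smooth_on_const: "smooth_on (\<lambda>x. c) U"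
  unfolding smooth_on_def using Ck_on_const by blast

lemma smooth_on_bounded_linear: "bounded_linear T \<Longrightarrow> open U \<Longrightarrow> smooth_on T U"
  unfolding smooth_on_def using Ck_on_bounded_linear by blast

lemma smooth_on_add:
  "open U \<Longrightarrow> smooth_on f U \<Longrightarrow> smooth_on g U \<Longrightarrow> smooth_on (\<lambda>x. f x + g x) U"
  unfolding smooth_on_def using Ck_on_add by blast

lemma smooth_on_bounded_bilinear:
  "bounded_bilinear B \<Longrightarrow> open U \<Longrightarrow> smooth_on f U \<Longrightarrow> smooth_on g U \<Longrightarrow> smooth_on (\<lambda>x. B (f x) (g x)) U"
  unfolding smooth_on_def using Ck_on_bounded_bilinear by blast

lemma smooth_on_compose:
  fixes f :: "'a::real_normed_vector \<Rightarrow> 'b::euclidean_space"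
    and g :: "'b \<Rightarrow> 'c::real_normed_vector"
  assumes "open U" "f ` U \<subseteq> V" "smooth_on f U" "smooth_on g V"
  shows "smooth_on (\<lambda>x. g (f x)) U"
  using assms Ck_on_compose unfolding smooth_on_def by blast

lemma smooth_on_Pair:
  fixes f :: "'a::real_normed_vector \<Rightarrow> 'b::euclidean_space"
    and g :: "'a \<Rightarrow> 'c::euclidean_space"
  assumes "open U" "smooth_on f U" "smooth_on g U"
  shows "smooth_on (\<lambda>x. (f x, g x)) U"
proof -
  have bl: "bounded_linear (\<lambda>y. (y, 0))" "bounded_linear (\<lambda>z. (0, z))"
    by (simp_all add: bounded_linear_Pair bounded_linear_ident bounded_linear_zero)
  have "smooth_on (\<lambda>x. (f x, 0 :: 'c)) U"
    using smooth_on_compose[OF assms(1) subset_UNIV assms(2) smooth_on_bounded_linear[OF bl(1) open_UNIV]] .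
  moreover have "smooth_on (\<lambda>x. (0 :: 'b, g x)) U"
    using smooth_on_compose[OF assms(1) subset_UNIV assms(3) smooth_on_bounded_linear[OF bl(2) open_UNIV]] .
  ultimately show ?thesis
    using smooth_on_add[OF assms(1)] by fastforce
qed

section \<open>Bump functions\<close>

text \<open>\<open>flat 0\<close> is the classical smooth function with all derivatives zero at 0.
  The powers in the denominator make the span of the family closed under differentiation, so
  smoothness follows by induction for all n at once.\<close>

definition flat :: "nat \<Rightarrow> real \<Rightarrow> real" where
  "flat n t = (if t > 0 then exp (- 1 / t) / t ^ n else 0)"

text \<open>With s = 1 / t the right-hand difference quotient becomes s^(n+1) / exp s, which tends
  to 0 as s grows; on the left it is identically 0.\<close>

lemma flat_has_derivative_zero: "(flat n has_real_derivative 0) (at 0)"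
proof -
  have "((\<lambda>x. x ^ Suc n / exp x) \<longlongrightarrow> (0::real)) at_top"
    by (rule tendsto_power_div_exp_0)
  then have "((\<lambda>t. inverse t ^ Suc n / exp (inverse t)) \<longlongrightarrow> (0::real)) (at_right 0)"
    by (rule filterlim_compose[OF _ filterlim_inverse_at_top_right])
  moreover have "\<forall>\<^sub>F t in at_right 0. inverse t ^ Suc n / exp (inverse t) = flat n t / (t::real)"
    by (auto simp: eventually_at_right_less eventually_at_filter flat_def exp_minus field_simps)
  ultimately have right: "((\<lambda>t. flat n t / t) \<longlongrightarrow> 0) (at_right 0)"
    by (rule Lim_transform_eventually)
  have "\<forall>\<^sub>F t in at_left 0. 0 = flat n t / t"
    by (auto simp: eventually_at_filter flat_def)
  then have left: "((\<lambda>t. flat n t / t) \<longlongrightarrow> 0) (at_left 0)"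
    by (rule Lim_transform_eventually[OF tendsto_const])
  show ?thesis
    unfolding has_field_derivative_iff using filterlim_split_at[OF left right]
    by (simp add: flat_def)
qed

lemma flat_has_derivative:
  "(flat n has_real_derivative flat (n + 2) t - real n * flat (n + 1) t) (at t)"
proof (cases t "0 :: real" rule: linorder_cases)
  case less
  have "(flat n has_real_derivative 0) (at t)"
    by (rule has_field_derivative_transform_within_open[of "\<lambda>_. 0" _ _ "{..<0}"])
      (use less in \<open>auto simp: flat_def\<close>)
  then show ?thesis using less by (simp add: flat_def)
next
  case equal
  then show ?thesis using flat_has_derivative_zero[of n] by (simp add: flat_def)
next
  case greater
  have "((\<lambda>t. exp (- 1 / t) / t ^ n) has_real_derivative flat (n + 2) t - real n * flat (n + 1) t) (at t)"
  \<comment> \<open>The power rule lowers the exponent with truncated subtraction; splitting off n =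
    0 leaves a genuine predecessor.\<close>
  proof (cases n)
    case 0
    show ?thesis
      using greater unfolding 0
      by (auto intro!: derivative_eq_intros simp: flat_def power2_eq_square)
  next
    case (Suc m)
    have "((\<lambda>t. exp (- 1 / t)) has_real_derivative exp (- 1 / t) / t\<^sup>2) (at t)"
      using greater by (auto intro!: derivative_eq_intros simp: power2_eq_square)
    from DERIV_divide[OF this DERIV_pow[of "Suc m"]] show ?thesis
      unfolding Suc
      by (rule DERIV_cong) (use greater in \<open>simp_all add: flat_def field_simps power2_eq_square\<close>)
  qed
  then show ?thesis
    by (rule has_field_derivative_transform_within_open[of _ _ _ "{0<..}"])
      (use greater in \<open>auto simp: flat_def\<close>)
qed

lemma smooth_on_flat: "smooth_on (flat n) UNIV"
proof -
  have "Ck_on k (flat n) UNIV" for k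
  proof (induction k arbitrary: n)
    case 0
    show ?case
      using flat_has_derivative by (auto intro!: DERIV_continuous_on)
  next
    case (Suc k)
    show ?case
    proof (rule Ck_on_SucI[OF open_UNIV])
      show "(flat n has_derivative (\<lambda>v. (flat (n + 2) t + (- real n) * flat (n + 1) t) * v)) (at t)" for t
        using flat_has_derivative[of n t] by (simp add: has_field_derivative_def)
      show "Ck_on k (\<lambda>t. (flat (n + 2) t + (- real n) * flat (n + 1) t) * v) UNIV" for v
        by (intro Ck_on_bounded_bilinear[OF bounded_bilinear_mult] Ck_on_add Ck_on_const Suc open_UNIV)
    qed
  qed
  then show ?thesis by (simp add: smooth_on_def)
qed

text \<open>A bump that is constant near \<open>u\<close> has zero derivative there, so a non-zero
  slope is demanded instead of the value 1. The compact support permits extension by zero on a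
  manifold.\<close>

lemma smooth_bump:
  fixes u v :: "'e::euclidean_space"
  assumes "open W" "u \<in> W" "v \<noteq> 0"
  obtains h :: "'e \<Rightarrow> real" and K where
    "smooth_on h UNIV" "compact K" "K \<subseteq> W" "\<And>x. x \<notin> K \<Longrightarrow> h x = 0"
    "frechet_derivative h (at u) v \<noteq> 0"
proof -
  obtain r where r: "r > 0" "cball u r \<subseteq> W"
    using assms open_contains_cball by blast
  \<comment> \<open>The bump is centred off \<open>u\<close> in the direction \<open>v\<close>, so that \<open>u\<close> lies on its slope.\<close>
  define c where "c = u + (r / (4 * norm v)) *\<^sub>R v"
  define q where "q x = (r / 2)\<^sup>2 - (x - c) \<bullet> (x - c)" for x
  define h where "h x = flat 0 (q x)" for x
  \<comment> \<open>Since \<open>u\<close> is at distance r/4 from \<open>c\<close>, it lies inside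
    this ball of radius r/2, and the ball stays within 3r/4 of \<open>u\<close>, hence in
    \<open>W\<close>. The paraboloid \<open>q\<close> is negative off the ball, where
    \<open>flat 0\<close> vanishes.\<close>
  define K where "K = cball c (r / 2)"
  have sub: "smooth_on (\<lambda>x. x - c) UNIV"
    using smooth_on_add[OF open_UNIV smooth_on_bounded_linear[OF bounded_linear_ident open_UNIV]
        smooth_on_const[of "- c"]] by simp
  have "smooth_on (\<lambda>x. (r / 2)\<^sup>2 + (- 1) * ((x - c) \<bullet> (x - c))) UNIV"
    by (intro smooth_on_add smooth_on_bounded_bilinear[OF bounded_bilinear_mult]
        smooth_on_bounded_bilinear[OF bounded_bilinear_inner] smooth_on_const sub open_UNIV)
  then have "smooth_on q UNIV"
    by (simp add: q_def[abs_def])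
  then have smooth: "smooth_on h UNIV"
    unfolding h_def by (rule smooth_on_compose[OF open_UNIV subset_UNIV _ smooth_on_flat])
  have "dist u c = r / 4"
    using assms(3) r(1) by (simp add: c_def dist_norm)
  then have KW: "K \<subseteq> W"
    using r subset_trans[OF _ r(2)] by (simp add: K_def cball_subset_cball_iff dist_commute)
  have supp: "h x = 0" if "x \<notin> K" for x
  proof -
    have "r / 2 < norm (x - c)"
      using that by (simp add: K_def dist_norm norm_minus_commute)
    then have "(r / 2)\<^sup>2 < (norm (x - c))\<^sup>2"
      using r(1) by (intro power_strict_mono) auto
    then show ?thesis
      by (simp add: h_def flat_def q_def power2_norm_eq_inner)
  qed
  have "(q has_derivative (\<lambda>w. - 2 * ((u - c) \<bullet> w))) (at u)"
    unfolding q_def by (auto intro!: derivative_eq_intros simp: inner_commute)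
  then have "(h has_derivative (\<lambda>w. flat 2 (q u) * (- 2 * ((u - c) \<bullet> w)))) (at u)"
    unfolding h_def using flat_has_derivative[of 0 "q u"]
    by (intro has_derivative_compose[of q _ u UNIV "flat 0"])
      (simp_all add: has_field_derivative_def numeral_2_eq_2)
  then have D: "frechet_derivative h (at u) = (\<lambda>w. flat 2 (q u) * (- 2 * ((u - c) \<bullet> w)))"
    using frechet_derivative_at by metis
  have "q u = (r / 2)\<^sup>2 - (r / 4)\<^sup>2"
    unfolding q_def power2_norm_eq_inner[symmetric] \<open>dist u c = r / 4\<close>[unfolded dist_norm] ..
  also have "\<dots> = 3 / 16 * r\<^sup>2"
    by (simp add: power_divide)
  finally have "q u > 0"
    using zero_less_power[OF r(1), of 2] by linarith
  moreover have "(u - c) \<bullet> v \<noteq> 0"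
    using assms(3) r(1) by (simp add: c_def)
  ultimately have "frechet_derivative h (at u) v \<noteq> 0"
    unfolding D by (simp add: flat_def)
  then show thesis
    using that[OF smooth _ KW supp] by (simp add: K_def)
qed

section \<open>Charts and smooth maps\<close>

lemma chart_inv_into:
  assumes "is_chart (U, \<phi>)" "x \<in> U"
  shows "inv_into U \<phi> (\<phi> x) = x"
  using assms by (auto simp: is_chart_def homeomorphism_def)

lemma chart_open_image:
  assumes "is_chart (U, \<phi>)" "open W" "W \<subseteq> U"
  shows "open (\<phi> ` W)"
proof -
  have "\<phi> ` W = \<phi> ` U \<inter> inv_into U \<phi> -` W"
    using assms(3) chart_inv_into[OF assms(1)] by force
  then show ?thesis
    using assms(1,2) by (auto simp: is_chart_def homeomorphism_def intro: continuous_open_preimage)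
qed

lemma chart_continuous: "is_chart (U, \<phi>) \<Longrightarrow> continuous_on U \<phi>"
  by (simp add: is_chart_def homeomorphism_def)

lemma chart_continuous_inv: "is_chart (U, \<phi>) \<Longrightarrow> continuous_on (\<phi> ` U) (inv_into U \<phi>)"
  by (simp add: is_chart_def homeomorphism_def)

lemma chart_open: "is_chart (U, \<phi>) \<Longrightarrow> open U"
  by (simp add: is_chart_def)

text \<open>\<open>inv_into\<close> chooses a preimage, so it splits into components only because
  injectivity makes the preimage unique. Coordinate computations on product charts rest on
  this.\<close>

lemma prod_chart_inv_into:
  assumes "is_chart (U, \<phi>)" "is_chart (V, \<psi>)" "z \<in> \<phi> ` U \<times> \<psi> ` V"
  shows "inv_into (U \<times> V) (map_prod \<phi> \<psi>) z = (inv_into U \<phi> (fst z), inv_into V \<psi> (snd z))"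
proof -
  obtain a b where ab: "a \<in> U" "b \<in> V" "z = map_prod \<phi> \<psi> (a, b)"
    using assms(3) by auto
  have "inj_on \<phi> U" "inj_on \<psi> V"
    using chart_inv_into[OF assms(1)] chart_inv_into[OF assms(2)] by (metis inj_onI)+
  then have "inj_on (map_prod \<phi> \<psi>) (U \<times> V)"
    by (rule map_prod_inj_on)
  then show ?thesis
    using ab chart_inv_into[OF assms(1)] chart_inv_into[OF assms(2)]
    by (simp add: inv_into_f_f del: map_prod_simp)
qed

lemma is_chart_prod:
  assumes "is_chart (U, \<phi>)" "is_chart (V, \<psi>)"
  shows "is_chart (U \<times> V, map_prod \<phi> \<psi>)"
proof -
  have im: "map_prod \<phi> \<psi> ` (U \<times> V) = \<phi> ` U \<times> \<psi> ` V"
    by auto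
  have "continuous_on (U \<times> V) (\<lambda>z. (\<phi> (fst z), \<psi> (snd z)))"
    by (intro continuous_on_Pair continuous_on_compose2[OF chart_continuous[OF assms(1)]]
        continuous_on_compose2[OF chart_continuous[OF assms(2)]] continuous_intros) auto
  then have 1: "continuous_on (U \<times> V) (map_prod \<phi> \<psi>)"
    by (simp add: map_prod_def case_prod_beta')
  have "continuous_on (\<phi> ` U \<times> \<psi> ` V) (\<lambda>z. (inv_into U \<phi> (fst z), inv_into V \<psi> (snd z)))"
    by (intro continuous_on_Pair continuous_on_compose2[OF chart_continuous_inv[OF assms(1)]]
        continuous_on_compose2[OF chart_continuous_inv[OF assms(2)]] continuous_intros) auto
  then have 2: "continuous_on (\<phi> ` U \<times> \<psi> ` V) (inv_into (U \<times> V) (map_prod \<phi> \<psi>))"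
    by (rule continuous_on_eq) (simp add: prod_chart_inv_into[OF assms])
  have 3: "inv_into (U \<times> V) (map_prod \<phi> \<psi>) (map_prod \<phi> \<psi> z) = z" if "z \<in> U \<times> V" for z
    using that by (subst prod_chart_inv_into[OF assms]) (auto simp: chart_inv_into assms)
  have "open (U \<times> V)" "open (\<phi> ` U \<times> \<psi> ` V)"
    using assms by (auto simp: is_chart_def intro: open_Times)
  moreover have "homeomorphism (U \<times> V) (\<phi> ` U \<times> \<psi> ` V) (map_prod \<phi> \<psi>) (inv_into (U \<times> V) (map_prod \<phi> \<psi>))"
  proof (rule homeomorphismI)
    show "inv_into (U \<times> V) (map_prod \<phi> \<psi>) ` (\<phi> ` U \<times> \<psi> ` V) \<subseteq> U \<times> V"
      unfolding im[symmetric] using 3 by fastforce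
    show "map_prod \<phi> \<psi> (inv_into (U \<times> V) (map_prod \<phi> \<psi>) y) = y" if "y \<in> \<phi> ` U \<times> \<psi> ` V" for y
      using that unfolding im[symmetric] by (rule f_inv_into_f)
  qed (use 1 2 3 im in auto)
  ultimately show ?thesis
    by (simp add: is_chart_def im)
qed

section \<open>Atlases, smooth maps and products of manifolds\<close>

lemma atlas_chart: "smooth_atlas A \<Longrightarrow> c \<in> A \<Longrightarrow> is_chart c"
  by (simp add: smooth_atlas_def)

lemma atlas_cover:
  assumes "smooth_atlas A"
  obtains U \<phi> where "(U, \<phi>) \<in> A" "p \<in> U"
proof -
  have "p \<in> (\<Union>c\<in>A. fst c)"
    using assms by (simp add: smooth_atlas_def)
  then show thesis using that by auto
qed

lemma atlas_transition:
  "smooth_atlas A \<Longrightarrow> (U, \<phi>) \<in> A \<Longrightarrow> (V, \<psi>) \<in> A \<Longrightarrow> smooth_on (\<psi> \<circ> inv_into U \<phi>) (\<phi> ` (U \<inter> V))"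
  unfolding smooth_atlas_def by blast

lemma smooth_map_chart:
  "smooth_map A B F \<Longrightarrow> (U, \<phi>) \<in> A \<Longrightarrow> (V, \<psi>) \<in> B
    \<Longrightarrow> smooth_on (\<psi> \<circ> F \<circ> inv_into U \<phi>) (\<phi> ` (U \<inter> F -` V))"
  unfolding smooth_map_def by blast

lemma smooth_map_continuous: "smooth_map A B F \<Longrightarrow> continuous_on UNIV F"
  by (simp add: smooth_map_def)

lemma chart_open_image_vimage:
  assumes "is_chart (U, \<phi>)" "continuous_on UNIV F" "open V"
  shows "open (\<phi> ` (U \<inter> F -` V))"
  using assms chart_open[OF assms(1)]
  by (intro chart_open_image) (auto intro: open_vimage)

text \<open>Over one chart of \<open>A\<close> the map need not pass through a single chart of
  \<open>B\<close>. Near each point a chart around \<open>F p\<close> is inserted, and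
  \<open>N\<close> is the part on which F lands in it. Asking only open domains of \<open>C\<close>
  covers the family \<open>{(UNIV, id)}\<close> that defines smooth functions.\<close>

lemma smooth_map_compose:
  assumes A: "smooth_atlas A" and B: "smooth_atlas B"
    and F: "smooth_map A B F" and G: "smooth_map B C G" and C: "\<And>c. c \<in> C \<Longrightarrow> open (fst c)"
  shows "smooth_map A C (G \<circ> F)"
proof -
  have cont: "continuous_on UNIV (G \<circ> F)"
    using smooth_map_continuous[OF F] smooth_map_continuous[OF G]
    by (metis continuous_on_compose continuous_on_subset subset_UNIV)
  have "smooth_on (\<xi> \<circ> (G \<circ> F) \<circ> inv_into U \<phi>) (\<phi> ` (U \<inter> (G \<circ> F) -` W))"
    if U: "(U, \<phi>) \<in> A" and W: "(W, \<xi>) \<in> C" for U \<phi> W \<xi>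
  proof (rule smooth_on_local, clarsimp)
    note cU = atlas_chart[OF A U]
    fix p assume p: "p \<in> U" "G (F p) \<in> W"
    obtain V \<psi> where V: "(V, \<psi>) \<in> B" "F p \<in> V"
      using atlas_cover[OF B] by metis
    note cV = atlas_chart[OF B V(1)]
    define N where "N = \<phi> ` (U \<inter> F -` (V \<inter> G -` W))"
    have "open (V \<inter> G -` W)"
      using chart_open[OF cV] C[OF W] smooth_map_continuous[OF G] by (auto intro!: open_Int open_vimage)
    then have "open N"
      unfolding N_def by (intro chart_open_image_vimage[OF cU smooth_map_continuous[OF F]])
    moreover have "\<phi> p \<in> N"
      using p V by (auto simp: N_def)
    moreover have "smooth_on (\<xi> \<circ> (G \<circ> F) \<circ> inv_into U \<phi>) N"
    proof (rule smooth_on_cong[OF _ \<open>open N\<close>])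
      have "smooth_on (\<psi> \<circ> F \<circ> inv_into U \<phi>) N"
        by (rule smooth_on_subset[OF smooth_map_chart[OF F U V(1)]]) (auto simp: N_def)
      moreover have "(\<psi> \<circ> F \<circ> inv_into U \<phi>) ` N \<subseteq> \<psi> ` (V \<inter> G -` W)"
        by (auto simp: N_def chart_inv_into[OF cU])
      ultimately show "smooth_on (\<lambda>x. (\<xi> \<circ> G \<circ> inv_into V \<psi>) ((\<psi> \<circ> F \<circ> inv_into U \<phi>) x)) N"
        by (intro smooth_on_compose[OF \<open>open N\<close> _ _ smooth_map_chart[OF G V(1) W]])
    qed (auto simp: N_def chart_inv_into[OF cU] chart_inv_into[OF cV])
    ultimately show "\<exists>N. open N \<and> \<phi> p \<in> N \<and> smooth_on (\<xi> \<circ> (G \<circ> F) \<circ> inv_into U \<phi>) N"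
      by blast
  qed
  then show ?thesis
    unfolding smooth_map_def using cont by blast
qed

lemma smooth_map_id:
  assumes "smooth_atlas A"
  shows "smooth_map A A (\<lambda>x. x)"
  unfolding smooth_map_def using atlas_transition[OF assms] by (auto simp: comp_def)

lemma smooth_map_const: "smooth_map A B (\<lambda>x. c)"
  unfolding smooth_map_def by (auto simp: comp_def smooth_on_const)

lemma smooth_map_Pair:
  assumes A: "smooth_atlas A" and B: "smooth_atlas B" and C: "smooth_atlas C"
    and F: "smooth_map A B F" and G: "smooth_map A C G"
  shows "smooth_map A (prod_atlas B C) (\<lambda>x. (F x, G x))"
proof -
  have cont: "continuous_on UNIV (\<lambda>x. (F x, G x))"
    by (intro continuous_on_Pair smooth_map_continuous[OF F] smooth_map_continuous[OF G])
  have "smooth_on (map_prod \<psi> \<xi> \<circ> (\<lambda>x. (F x, G x)) \<circ> inv_into U \<phi>)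
      (\<phi> ` (U \<inter> (\<lambda>x. (F x, G x)) -` (V \<times> W)))" (is "smooth_on _ ?N")
    if U: "(U, \<phi>) \<in> A" and V: "(V, \<psi>) \<in> B" and W: "(W, \<xi>) \<in> C" for U \<phi> V \<psi> W \<xi>
  proof -
    have N: "open ?N"
      using chart_open[OF atlas_chart[OF B V]] chart_open[OF atlas_chart[OF C W]]
      by (intro chart_open_image_vimage[OF atlas_chart[OF A U] cont] open_Times)
    have "smooth_on (\<psi> \<circ> F \<circ> inv_into U \<phi>) ?N"
      by (rule smooth_on_subset[OF smooth_map_chart[OF F U V]]) auto
    moreover have "smooth_on (\<xi> \<circ> G \<circ> inv_into U \<phi>) ?N"
      by (rule smooth_on_subset[OF smooth_map_chart[OF G U W]]) auto
    ultimately have "smooth_on (\<lambda>x. ((\<psi> \<circ> F \<circ> inv_into U \<phi>) x, (\<xi> \<circ> G \<circ> inv_into U \<phi>) x)) ?N"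
      by (rule smooth_on_Pair[OF N])
    moreover have "map_prod \<psi> \<xi> \<circ> (\<lambda>x. (F x, G x)) \<circ> inv_into U \<phi>
        = (\<lambda>x. ((\<psi> \<circ> F \<circ> inv_into U \<phi>) x, (\<xi> \<circ> G \<circ> inv_into U \<phi>) x))"
      by auto
    ultimately show ?thesis
      by metis
  qed
  then show ?thesis
    unfolding smooth_map_def prod_atlas_def using cont by blast
qed

lemma prod_atlas_chart:
  assumes "smooth_atlas A" "smooth_atlas B" "c \<in> prod_atlas A B"
  shows "is_chart c"
  using assms(3) by (auto simp: prod_atlas_def intro!: is_chart_prod atlas_chart[OF assms(1)] atlas_chart[OF assms(2)])

text \<open>In coordinates this is the linear projection followed by a transition map of the first
  factor.\<close>

lemma smooth_map_fst:
  assumes A: "smooth_atlas A" and B: "smooth_atlas B"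
  shows "smooth_map (prod_atlas A B) A fst"
proof -
  have "smooth_on (\<xi> \<circ> fst \<circ> inv_into (U \<times> V) (map_prod \<phi> \<psi>))
      (map_prod \<phi> \<psi> ` ((U \<times> V) \<inter> fst -` W))" (is "smooth_on _ ?N")
    if U: "(U, \<phi>) \<in> A" and V: "(V, \<psi>) \<in> B" and W: "(W, \<xi>) \<in> A" for U \<phi> V \<psi> W \<xi>
  proof (rule smooth_on_cong)
    note c = atlas_chart[OF A U] atlas_chart[OF B V]
    show N: "open ?N"
      using chart_open[OF atlas_chart[OF A W]]
      by (rule chart_open_image_vimage[OF is_chart_prod[OF c] continuous_on_fst[OF continuous_on_id]])
    show "smooth_on (\<lambda>z. (\<xi> \<circ> inv_into U \<phi>) (fst z)) ?N"
      by (rule smooth_on_compose[OF N _ smooth_on_bounded_linear[OF bounded_linear_fst N]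
            atlas_transition[OF A U W]]) auto
    fix z assume "z \<in> ?N"
    then have "z \<in> \<phi> ` U \<times> \<psi> ` V"
      by auto
    from prod_chart_inv_into[OF c this]
    show "(\<xi> \<circ> inv_into U \<phi>) (fst z) = (\<xi> \<circ> fst \<circ> inv_into (U \<times> V) (map_prod \<phi> \<psi>)) z"
      by simp
  qed
  then show ?thesis
    unfolding smooth_map_def prod_atlas_def using continuous_on_fst[OF continuous_on_id] by blast
qed

lemma smooth_map_snd:
  assumes A: "smooth_atlas A" and B: "smooth_atlas B"
  shows "smooth_map (prod_atlas A B) B snd"
proof -
  have "smooth_on (\<xi> \<circ> snd \<circ> inv_into (U \<times> V) (map_prod \<phi> \<psi>))
      (map_prod \<phi> \<psi> ` ((U \<times> V) \<inter> snd -` W))" (is "smooth_on _ ?N")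
    if U: "(U, \<phi>) \<in> A" and V: "(V, \<psi>) \<in> B" and W: "(W, \<xi>) \<in> B" for U \<phi> V \<psi> W \<xi>
  proof (rule smooth_on_cong)
    note c = atlas_chart[OF A U] atlas_chart[OF B V]
    show N: "open ?N"
      using chart_open[OF atlas_chart[OF B W]]
      by (rule chart_open_image_vimage[OF is_chart_prod[OF c] continuous_on_snd[OF continuous_on_id]])
    show "smooth_on (\<lambda>z. (\<xi> \<circ> inv_into V \<psi>) (snd z)) ?N"
      by (rule smooth_on_compose[OF N _ smooth_on_bounded_linear[OF bounded_linear_snd N]
            atlas_transition[OF B V W]]) auto
    fix z assume "z \<in> ?N"
    then have "z \<in> \<phi> ` U \<times> \<psi> ` V"
      by auto
    from prod_chart_inv_into[OF c this]
    show "(\<xi> \<circ> inv_into V \<psi>) (snd z) = (\<xi> \<circ> snd \<circ> inv_into (U \<times> V) (map_prod \<phi> \<psi>)) z"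
      by simp
  qed
  then show ?thesis
    unfolding smooth_map_def prod_atlas_def using continuous_on_snd[OF continuous_on_id] by blast
qed

text \<open>The components of a transition map are coordinate expressions of \<open>fst\<close> and
  \<open>snd\<close>, whose smoothness came from the factor atlases alone, so there is no
  circularity.\<close>

lemma smooth_atlas_prod:
  assumes A: "smooth_atlas A" and B: "smooth_atlas B"
  shows "smooth_atlas (prod_atlas A B)"
proof -
  have cover: "\<exists>c\<in>prod_atlas A B. z \<in> fst c" for z
  proof -
    obtain U \<phi> where U: "(U, \<phi>) \<in> A" "fst z \<in> U"
      using atlas_cover[OF A] by metis
    obtain V \<psi> where V: "(V, \<psi>) \<in> B" "snd z \<in> V"
      using atlas_cover[OF B] by metis
    show ?thesis
      using U V by (intro bexI[of _ "(U \<times> V, map_prod \<phi> \<psi>)"]) (auto simp: prod_atlas_def mem_Times_iff)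
  qed
  have "smooth_on (\<psi> \<circ> inv_into U \<phi>) (\<phi> ` (U \<inter> V))"
    if U: "(U, \<phi>) \<in> prod_atlas A B" and V: "(V, \<psi>) \<in> prod_atlas A B" for U \<phi> V \<psi>
  proof -
    obtain U1 \<phi>1 U2 \<phi>2 where U': "(U1, \<phi>1) \<in> A" "(U2, \<phi>2) \<in> B" "U = U1 \<times> U2" "\<phi> = map_prod \<phi>1 \<phi>2"
      using U by (auto simp: prod_atlas_def)
    obtain V1 \<psi>1 V2 \<psi>2 where V': "(V1, \<psi>1) \<in> A" "(V2, \<psi>2) \<in> B" "V = V1 \<times> V2" "\<psi> = map_prod \<psi>1 \<psi>2"
      using V by (auto simp: prod_atlas_def)
    have N: "open (\<phi> ` (U \<inter> V))"
      using prod_atlas_chart[OF A B U] chart_open[OF prod_atlas_chart[OF A B U]]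
        chart_open[OF prod_atlas_chart[OF A B V]]
      by (intro chart_open_image) auto
    have "smooth_on (\<psi>1 \<circ> fst \<circ> inv_into U \<phi>) (\<phi> ` (U \<inter> V))"
      by (rule smooth_on_subset[OF smooth_map_chart[OF smooth_map_fst[OF A B] U V'(1)]]) (auto simp: V')
    moreover have "smooth_on (\<psi>2 \<circ> snd \<circ> inv_into U \<phi>) (\<phi> ` (U \<inter> V))"
      by (rule smooth_on_subset[OF smooth_map_chart[OF smooth_map_snd[OF A B] U V'(2)]]) (auto simp: V')
    ultimately show ?thesis
      using smooth_on_Pair[OF N] by (simp add: V' comp_def map_prod_def case_prod_beta)
  qed
  then show ?thesis
    unfolding smooth_atlas_def using prod_atlas_chart[OF A B] cover by blast
qed

section \<open>The algebra of smooth functions\<close>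

lemma smooth_functions_chart:
  assumes "f \<in> smooth_functions A" "(U, \<phi>) \<in> A"
  shows "smooth_on (\<lambda>u. f (inv_into U \<phi> u)) (\<phi> ` U)"
  using smooth_map_chart[OF _ assms(2), of "{(UNIV, id)}" f UNIV id] assms(1)
  by (simp add: smooth_functions_def comp_def)

text \<open>Global continuity, a separate clause of \<open>smooth_map\<close>, is recovered from the
  coordinate expressions because the open chart domains cover the space.\<close>

lemma smooth_functionsI:
  assumes A: "smooth_atlas A"
    and f: "\<And>U \<phi>. (U, \<phi>) \<in> A \<Longrightarrow> smooth_on (\<lambda>u. f (inv_into U \<phi> u)) (\<phi> ` U)"
  shows "f \<in> smooth_functions A"
proof -
  have "continuous_on (fst c) f" if "c \<in> A" for c
  proof -
    obtain U \<phi> where U: "c = (U, \<phi>)"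
      by fastforce
    note cU = atlas_chart[OF A that, unfolded U]
    have "continuous_on U (\<lambda>q. f (inv_into U \<phi> (\<phi> q)))"
      using that unfolding U
      by (intro continuous_on_compose2[OF smooth_on_continuous[OF f] chart_continuous[OF cU]]) auto
    then have "continuous_on U f"
      by (rule continuous_on_eq) (simp add: chart_inv_into[OF cU])
    then show ?thesis
      by (simp add: U)
  qed
  moreover have "open (fst c)" if "c \<in> A" for c
    using chart_open[of "fst c" "snd c"] atlas_chart[OF A that] by simp
  ultimately have "continuous_on (\<Union>c\<in>A. fst c) f"
    by (intro continuous_on_open_UN) auto
  then have "continuous_on UNIV f"
    using A by (simp add: smooth_atlas_def)
  then show ?thesis
    using f by (auto simp: smooth_functions_def smooth_map_def comp_def)
qed

lemma smooth_functions_compose: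
  assumes "smooth_atlas A" "smooth_atlas B" "smooth_map A B F" "f \<in> smooth_functions B"
  shows "(\<lambda>x. f (F x)) \<in> smooth_functions A"
  using smooth_map_compose[OF assms(1-3)] assms(4) by (fastforce simp: smooth_functions_def comp_def)

lemma smooth_functions_mult:
  assumes A: "smooth_atlas A" and f: "f \<in> smooth_functions A" and g: "g \<in> smooth_functions A"
  shows "(\<lambda>x. f x * g x) \<in> smooth_functions A"
  using atlas_chart[OF A]
  by (intro smooth_functionsI[OF A] smooth_on_bounded_bilinear[OF bounded_bilinear_mult]
      smooth_functions_chart[OF f] smooth_functions_chart[OF g]) (auto simp: is_chart_def)

lemma smooth_functions_add:
  assumes A: "smooth_atlas A" and f: "f \<in> smooth_functions A" and g: "g \<in> smooth_functions A"
  shows "(\<lambda>x. f x + g x) \<in> smooth_functions A"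
  using atlas_chart[OF A]
  by (intro smooth_functionsI[OF A] smooth_on_add
      smooth_functions_chart[OF f] smooth_functions_chart[OF g]) (auto simp: is_chart_def)

lemma smooth_functions_const: "smooth_atlas A \<Longrightarrow> (\<lambda>x. c) \<in> smooth_functions A"
  by (intro smooth_functionsI smooth_on_const)

text \<open>A coordinate bump is extended by zero outside the chart. In a Hausdorff space the
  compact support \<open>K'\<close> is closed, so its complement is open and together with
  \<open>U\<close> covers the manifold; the extension is smooth on both pieces.\<close>

lemma smooth_functions_nonzero_derivative:
  fixes A :: "('s::t2_space, 'e::euclidean_space) chart set"
  assumes A: "smooth_atlas A" and U: "(U, \<phi>) \<in> A" "p \<in> U" and "v \<noteq> 0"
  obtains f where "f \<in> smooth_functions A"
    "frechet_derivative (\<lambda>u. f (inv_into U \<phi> u)) (at (\<phi> p)) v \<noteq> 0"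
proof -
  note cU = atlas_chart[OF A U(1)]
  have imU: "open (\<phi> ` U)" "\<phi> p \<in> \<phi> ` U"
    using cU U(2) by (auto simp: is_chart_def)
  obtain h :: "'e \<Rightarrow> real" and K where h: "smooth_on h UNIV" "compact K" "K \<subseteq> \<phi> ` U"
    "\<And>x. x \<notin> K \<Longrightarrow> h x = 0" "frechet_derivative h (at (\<phi> p)) v \<noteq> 0"
    using smooth_bump[OF imU \<open>v \<noteq> 0\<close>] by metis
  define f where "f q = (if q \<in> U then h (\<phi> q) else 0)" for q
  define K' where "K' = inv_into U \<phi> ` K"
  have "compact K'"
    unfolding K'_def using chart_continuous_inv[OF cU] h(2,3)
    by (meson compact_continuous_image continuous_on_subset)
  then have "closed K'"
    by (rule compact_imp_closed)
  have f0: "f q = 0" if "q \<notin> K'" for q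
    using that h(4)[of "\<phi> q"] chart_inv_into[OF cU, of q] by (force simp: f_def K'_def)
  have "f \<in> smooth_functions A"
  proof (rule smooth_functionsI[OF A], rule smooth_on_local)
    fix V \<psi> y assume V: "(V, \<psi>) \<in> A" and "y \<in> \<psi> ` V"
    note cV = atlas_chart[OF A V]
    then obtain q where q: "q \<in> V" "y = \<psi> q"
      using \<open>y \<in> \<psi> ` V\<close> by auto
    show "\<exists>N. open N \<and> y \<in> N \<and> smooth_on (\<lambda>u. f (inv_into V \<psi> u)) N"
    proof (cases "q \<in> U")
      case True
      let ?N = "\<psi> ` (V \<inter> U)"
      have N: "open ?N"
        using chart_open[OF cU] chart_open[OF cV] by (intro chart_open_image[OF cV]) auto
      have "smooth_on (\<lambda>u. h ((\<phi> \<circ> inv_into V \<psi>) u)) ?N"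
        by (rule smooth_on_compose[OF N subset_UNIV atlas_transition[OF A V U(1)] h(1)])
      then have "smooth_on (\<lambda>u. f (inv_into V \<psi> u)) ?N"
        by (rule smooth_on_cong[OF _ N]) (auto simp: f_def chart_inv_into[OF cV])
      then show ?thesis
        using N q True by blast
    next
      case False
      let ?N = "\<psi> ` (V - K')"
      have N: "open ?N"
        using chart_open[OF cV] \<open>closed K'\<close> by (intro chart_open_image[OF cV]) auto
      have "smooth_on (\<lambda>u. f (inv_into V \<psi> u)) ?N"
        by (rule smooth_on_cong[OF smooth_on_const[of 0] N]) (auto simp: f0 chart_inv_into[OF cV])
      moreover have "q \<notin> K'"
        using False h(3) by (auto simp: K'_def chart_inv_into[OF cU])
      ultimately show ?thesis
        using N q by blast
    qed
  qed
  moreover have "frechet_derivative (\<lambda>u. f (inv_into U \<phi> u)) (at (\<phi> p)) = frechet_derivative h (at (\<phi> p))"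
  proof (rule sym, rule frechet_derivative_transform_within_open[OF _ imU])
    show "h differentiable at (\<phi> p)"
      using smooth_on_has_derivative[OF h(1)] by (auto simp: differentiable_def)
  qed (auto simp: f_def chart_inv_into[OF cU])
  ultimately show thesis
    using that h(5) by simp
qed

section \<open>The left-invariant vector field of a tangent vector at the unit\<close>

context lie_semiheap
begin

lemmas atlas3 = smooth_atlas_prod[OF atlas smooth_atlas_prod[OF atlas atlas]]

lemma smooth_mu_compose:
  assumes B: "smooth_atlas B" and "smooth_map B A F" "smooth_map B A G" "smooth_map B A H"
    and f: "f \<in> smooth_functions A"
  shows "(\<lambda>x. f (\<mu> (F x) (G x) (H x))) \<in> smooth_functions B"
proof -
  have "smooth_map B (prod_atlas A (prod_atlas A A)) (\<lambda>x. (F x, G x, H x))"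
    using assms by (intro smooth_map_Pair smooth_atlas_prod atlas)
  from smooth_functions_compose[OF B atlas3 this smooth_functions_compose[OF atlas3 atlas smooth_mu f]]
  show ?thesis by simp
qed

lemma smooth_left_translation:
  "f \<in> smooth_functions A \<Longrightarrow> (\<lambda>z. f (\<mu> x y z)) \<in> smooth_functions A"
  by (intro smooth_mu_compose atlas smooth_map_const smooth_map_id)

text \<open>The reversed middle bracket is only the bridge between the two outer
  bracketings.\<close>

lemma para_assoc: "\<mu> (\<mu> x y z) w u = \<mu> x y (\<mu> z w u)"
  using para_assoc_left para_assoc_right by simp

end

context biunital_lie_semiheap
begin

context
  fixes U :: "'s set" and \<phi> :: "'s \<Rightarrow> 'e" and v :: 'e
  assumes U: "(U, \<phi>) \<in> A" "x0 \<in> U"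
begin

text \<open>
  The left translation of the tangent vector at \<open>x0\<close> with coordinates \<open>v\<close>.
  It has to vanish on non-smooth functions in order to belong to \<^const>\<open>tangent_space\<close>.
\<close>

definition translated_field :: "'s vfield" where
  "translated_field p f = (if f \<in> smooth_functions A
     then frechet_derivative (\<lambda>u. f (\<mu> p x0 (inv_into U \<phi> u))) (at (\<phi> x0)) v else 0)"

lemma translated_slice_has_derivative:
  assumes "f \<in> smooth_functions A"
  shows "((\<lambda>u. f (\<mu> p x0 (inv_into U \<phi> u))) has_derivative
    frechet_derivative (\<lambda>u. f (\<mu> p x0 (inv_into U \<phi> u))) (at (\<phi> x0))) (at (\<phi> x0))"
  using U(2) by (intro smooth_on_has_derivative[OF smooth_functions_chart[OF smooth_left_translation[OF assms] U(1)]]) auto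

lemma translated_field_eqI:
  assumes "f \<in> smooth_functions A"
    and "((\<lambda>u. f (\<mu> p x0 (inv_into U \<phi> u))) has_derivative D) (at (\<phi> x0))"
  shows "translated_field p f = D v"
  using frechet_derivative_at[OF assms(2)] assms(1) by (simp add: translated_field_def)

lemma translated_field_tangent: "translated_field p \<in> tangent_space A p"
  unfolding tangent_space_def mem_Collect_eq
proof (intro conjI ballI allI impI)
  fix f g assume f: "f \<in> smooth_functions A" and g: "g \<in> smooth_functions A"
  \<comment> \<open>The right unit makes the slice pass through p, so the product rule at
    \<open>\<phi> x0\<close> yields the factors f p and g p, that is, the Leibniz rule at p.\<close>
  have base: "\<mu> p x0 (inv_into U \<phi> (\<phi> x0)) = p"
    using U(2) by (simp add: chart_inv_into[OF atlas_chart[OF atlas U(1)]] right_unit)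
  note D = translated_slice_has_derivative[OF f, of p] translated_slice_has_derivative[OF g, of p]
  show "translated_field p (\<lambda>x. a * f x + b * g x) = a * translated_field p f + b * translated_field p g" for a b
  proof -
    have "(\<lambda>x. a * f x + b * g x) \<in> smooth_functions A"
      by (intro smooth_functions_add smooth_functions_mult smooth_functions_const atlas f g)
    from translated_field_eqI[OF this has_derivative_add[OF has_derivative_mult_right[OF D(1)] has_derivative_mult_right[OF D(2)]]]
    show ?thesis using f g by (simp add: translated_field_def)
  qed
  show "translated_field p (\<lambda>x. f x * g x) = f p * translated_field p g + g p * translated_field p f"
    using translated_field_eqI[OF smooth_functions_mult[OF atlas f g] has_derivative_mult[OF D]] f g
    by (simp add: translated_field_def base mult.commute)
qed (simp add: translated_field_def)

lemma translated_field_smooth: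
  assumes f: "f \<in> smooth_functions A"
  shows "vf_apply translated_field f \<in> smooth_functions A"
proof (rule smooth_functionsI[OF atlas])
  fix V \<psi> assume V: "(V, \<psi>) \<in> A"
  note c = atlas_chart[OF atlas V] atlas_chart[OF atlas U(1)]
  have openV: "open (\<psi> ` V)" and openVU: "open (\<psi> ` V \<times> \<phi> ` U)"
    using c by (auto simp: is_chart_def intro: open_Times)
  define g where "g z = f (\<mu> (inv_into V \<psi> (fst z)) x0 (inv_into U \<phi> (snd z)))" for z
  have "(\<lambda>x. f (\<mu> (fst x) x0 (snd x))) \<in> smooth_functions (prod_atlas A A)"
    by (intro smooth_mu_compose smooth_atlas_prod atlas smooth_map_const smooth_map_fst smooth_map_snd f)
  moreover have "(V \<times> U, map_prod \<psi> \<phi>) \<in> prod_atlas A A"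
    using U(1) V by (auto simp: prod_atlas_def)
  ultimately have "smooth_on (\<lambda>z. (\<lambda>x. f (\<mu> (fst x) x0 (snd x))) (inv_into (V \<times> U) (map_prod \<psi> \<phi>) z))
      (map_prod \<psi> \<phi> ` (V \<times> U))"
    by (rule smooth_functions_chart)
  moreover have "map_prod \<psi> \<phi> ` (V \<times> U) = \<psi> ` V \<times> \<phi> ` U"
    by auto
  ultimately have "smooth_on (\<lambda>z. (\<lambda>x. f (\<mu> (fst x) x0 (snd x))) (inv_into (V \<times> U) (map_prod \<psi> \<phi>) z))
      (\<psi> ` V \<times> \<phi> ` U)"
    by simp
  then have g: "smooth_on g (\<psi> ` V \<times> \<phi> ` U)"
    by (rule smooth_on_cong[OF _ openVU]) (simp add: g_def prod_chart_inv_into[OF c])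
  have "smooth_on (\<lambda>w. (w, \<phi> x0)) (\<psi> ` V)"
    by (intro smooth_on_Pair openV smooth_on_const smooth_on_bounded_linear bounded_linear_ident)
  \<comment> \<open>The partial derivative is the full derivative of the jointly smooth
    \<open>g\<close> in the constant direction \<open>(0, v)\<close>, hence smooth, and then
    restricted to the slice through \<open>\<phi> x0\<close>.\<close>
  from smooth_on_compose[OF openV _ this smooth_on_derivative[OF g, of "(0, v)"]]
  have "smooth_on (\<lambda>w. frechet_derivative g (at (w, \<phi> x0)) (0, v)) (\<psi> ` V)"
    using U(2) by auto
  then show "smooth_on (\<lambda>w. vf_apply translated_field f (inv_into V \<psi> w)) (\<psi> ` V)"
  proof (rule smooth_on_cong[OF _ openV])
    fix w assume w: "w \<in> \<psi> ` V"
    have "(g has_derivative frechet_derivative g (at (w, \<phi> x0))) (at (w, \<phi> x0))"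
      using w U(2) by (intro smooth_on_has_derivative[OF g]) auto
    \<comment> \<open>The chain rule along the slice \<open>Pair w\<close> identifies this partial
      derivative with the one defining the field.\<close>
    moreover have "(Pair w has_derivative Pair 0) (at (\<phi> x0))"
      by (auto intro!: derivative_eq_intros)
    ultimately have "((\<lambda>u. g (w, u)) has_derivative (\<lambda>y. frechet_derivative g (at (w, \<phi> x0)) (0, y))) (at (\<phi> x0))"
      using has_derivative_compose by blast
    then show "frechet_derivative g (at (w, \<phi> x0)) (0, v) = vf_apply translated_field f (inv_into V \<psi> w)"
      using translated_field_eqI[OF f] by (simp add: g_def vf_apply_def)
  qed
qed

text \<open>By \<open>para_assoc\<close> both sides differentiate literally the same function of the
  coordinates at x0; \<open>smooth_left_translation\<close> keeps the pulled-back function out of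
  the default branch 0.\<close>

lemma translated_field_left_invariant: "left_invariant A \<mu> translated_field"
  by (auto simp: left_invariant_def left_translations_def pullback_def comp_def vf_apply_def
      translated_field_def smooth_left_translation para_assoc)

lemma translated_field_nonzero:
  assumes "v \<noteq> 0"
  shows "translated_field \<noteq> zero_vector_field"
proof -
  obtain f where f: "f \<in> smooth_functions A"
    "frechet_derivative (\<lambda>u. f (inv_into U \<phi> u)) (at (\<phi> x0)) v \<noteq> 0"
    using smooth_functions_nonzero_derivative[OF atlas U assms] by metis
  \<comment> \<open>The left unit turns the slice at x0 into the coordinate expression of f
    itself.\<close>
  then have "translated_field x0 f \<noteq> 0"
    by (simp add: translated_field_def left_unit)
  then show ?thesis
    by (auto simp: zero_vector_field_def)
qed

end

end

theorem theorem2p44: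
  fixes A :: "('s::{t2_space, second_countable_topology}, 'e::euclidean_space) chart set"
    and \<mu> :: "'s \<Rightarrow> 's \<Rightarrow> 's \<Rightarrow> 's"
    and x0 :: 's
  assumes "biunital_lie_semiheap A \<mu> x0"
  shows "\<exists>X. smooth_vector_field A X \<and> left_invariant A \<mu> X \<and> X \<noteq> zero_vector_field"
proof -
  interpret biunital_lie_semiheap A \<mu> x0
    by (rule assms)
  obtain U \<phi> where U: "(U, \<phi>) \<in> A" "x0 \<in> U"
    using atlas_cover[OF atlas] by metis
  \<comment> \<open>Positive dimension enters here: the basis of a Euclidean space type is
    nonempty.\<close>
  obtain v :: 'e where "v \<noteq> 0"
    using nonempty_Basis nonzero_Basis by blast
  then show ?thesis
    using translated_field_tangent[OF U] translated_field_smooth[OF U]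
      translated_field_left_invariant[OF U] translated_field_nonzero[OF U]
    unfolding smooth_vector_field_def by blast
qed

end
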